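(* Suppose $\mathbb{K}$ is a field of characteristic $0$. (i) If $A$ is a $C_\infty$-algebra over $\mathbb{K}$, then any closed element $h\in A$ of even degree is a twisting element. (ii) If $f\colon A\to B$ is a morphism of $C_\infty$-algebras, then $F_h(h)=f_1(h)$ (for $h\in A$ closed of even degree). (iii) If two $C_\infty$-algebra morphisms $f,g\colon A\to B$ are homotopic (as $C_\infty$-morphisms) through $\{\eta_n\}$, then $H_h(h)=\eta_1(h)$ (for $h\in A$ closed of even degree).
   Context: $A_\infty$-algebra: a $\mathbb{Z}$- or $\mathbb{Z}_2$-graded $\mathbb{K}$-vector space $A$ with graded multilinear maps $b_n\colon A^{\otimes n}\to A$ ($n\ge1$) of degree $1$ such that for each $n\ge1$, $\sum_{r,t\ge0,\,s\ge1,\,r+s+t=n}b_{r+1+t}\circ(1^{\otimes r}\otimes b_s\otimes1^{\otimes t})=0$ (Koszul sign rule). A morphism $f\colon A\to B$ is a family of multilinear maps $f_n\colon A^{\otimes n}\to B$ ($n\ge1$) of degree $0$ with, for each $n\ge1$, $\sum_{r,t\ge0,\,s\ge1,\,r+s+t=n}f_{r+1+t}\circ(1^{\otimes r}\otimes b^A_s\otimes1^{\otimes t})=\sum_{i_1+\cdots+i_r=n,\,i_j>0}b^B_r\circ(f_{i_1}\otimes\cdots\otimes f_{i_r})$. Morphisms $f,g$ are homotopic through multilinear maps $\eta_n\colon A^{\otimes n}\to B$ of degree $-1$ if for each $n\ge1$ $$g_n-f_n=\sum b^B_{r+1+t}\circ(g_{i_1}\otimes\cdots\otimes g_{i_r}\otimes\eta_s\otimes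 f_{j_1}\otimes\cdots\otimes f_{j_t})+\sum\eta_{r+1+t}\circ(1^{\otimes r}\otimes b^A_s\otimes1^{\otimes t}),$$ the first sum over $r,t\ge0$, $s\ge1$, $i_1,\dots,i_r,j_1,\dots,j_t>0$ with $i_1+\cdots+i_r+s+j_1+\cdots+j_t=n$, the second over $r,t\ge0$, $s\ge1$, $r+s+t=n$. Shuffle product on $\overline TA=\bigoplus_{n\ge1}A^{\otimes n}$: for $0<r<n$ and homogeneous $a_i$, $[a_1\otimes\cdots\otimes a_r]\Join[a_{r+1}\otimes\cdots\otimes a_n]=\sum_\sigma(-1)^{\varepsilon(\sigma)}a_{\sigma(1)}\otimes\cdots\otimes a_{\sigma(n)}$, the sum over permutations $\sigma$ of $\{1,\dots,n\}$ such that $1,\dots,r$ appear in increasing order in the word $\sigma(1)\cdots\sigma(n)$ and so do $r+1,\dots,n$; $\varepsilon(\sigma)=\sum|a_i||a_j|$ over pairs $i\le r<j$ such that $j$ appears before $i$ in that word. A $C_\infty$-algebra is an $A_\infty$-algebra such that for each $n\ge2$, $b_n$ vanishes on $\overline TA\Join\overline TA$ (its part in $A^{\otimes n}$). A morphism of $C_\infty$-algebras is an $A_\infty$-morphism such that for each $n\ge2$, $f_n$ vanishes on $\overline TA\Join\overline TA$; two such are homotopic if they are homotopic through $\{\eta_n\}$ such that for each $n\ge2$, $\eta_n$ vanishes on $\overline TA\Join\overline TA$. Closed means $b_1(h)=0$. A twisting element is an element $h$ of even degree with $\partial_hh=\sum_{n\ge1}b_n(\underbrace{h,\dots,h}_n)=0$.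 $F_h(h)=\sum_{n\ge1}f_n(\underbrace{h,\dots,h}_n)$ and $H_h(h)=\sum_{n\ge1}\eta_n(\underbrace{h,\dots,h}_n)$. *)

theory Defs
  imports Complex_Main "HOL-Combinatorics.Permutations" "HOL-Library.Z2"
begin

text \<open>
  Degrees live in a type of class \<open>ring_parity\<close>; the instances of interest are \<open>int\<close>
  (\<open>\<int>\<close>-graded case) and \<open>bit\<close> (\<open>\<int>\<^sub>2\<close>-graded case).  Only the ring structure and the parity of
  degrees are used.
\<close>

locale graded_vector_space = vector_space scale
  for scale :: "'k::field \<Rightarrow> 'a::ab_group_add \<Rightarrow> 'a" +
  fixes gr :: "'g::ring_parity \<Rightarrow> 'a set"
  assumes subspace_gr: "subspace (gr d)"
    and direct_sum_gr:
      "\<exists>!c. (\<forall>d. c d \<in> gr d) \<and> finite {d. c d \<noteq> 0} \<and> x = (\<Sum>d | c d \<noteq> 0. c d)"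

definition homogeneous :: "('g \<Rightarrow> 'a set) \<Rightarrow> 'g list \<Rightarrow> 'a list \<Rightarrow> bool" where
  "homogeneous gr ds xs \<longleftrightarrow> list_all2 (\<lambda>d x. x \<in> gr d) ds xs"

definition ksign :: "'g::ring_parity \<Rightarrow> 'k::field" where
  "ksign d = (if even d then 1 else - 1)"

text \<open>
  A family of multilinear maps \<open>A\<^bsup>\<otimes>n\<^esup> \<rightarrow> B\<close>, \<open>n \<ge> 1\<close>, is represented by
  \<open>\<phi> :: nat \<Rightarrow> 'a list \<Rightarrow> 'b\<close>, where \<open>\<phi> n [a\<^sub>1, \<dots>, a\<^sub>n]\<close> is the value of the \<open>n\<close>-th map on
  \<open>a\<^sub>1 \<otimes> \<dots> \<otimes> a\<^sub>n\<close>.  The values \<open>\<phi> n xs\<close> with \<open>length xs \<noteq> n\<close> or \<open>n = 0\<close> carry no meaning and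
  are never constrained or used.  Identities between multilinear maps are imposed on tensors
  of homogeneous elements, where the Koszul signs are defined.
\<close>

definition multilinear_family ::
  "('k::field \<Rightarrow> 'a::ab_group_add \<Rightarrow> 'a) \<Rightarrow> ('k \<Rightarrow> 'b::ab_group_add \<Rightarrow> 'b) \<Rightarrow>
    (nat \<Rightarrow> 'a list \<Rightarrow> 'b) \<Rightarrow> bool" where
  "multilinear_family sA sB \<phi> \<longleftrightarrow>
    (\<forall>n\<ge>1. \<forall>xs. length xs = n \<longrightarrow> (\<forall>i<n. Vector_Spaces.linear sA sB (\<lambda>x. \<phi> n (xs[i := x]))))"

definition has_degree ::
  "('g::ring_parity \<Rightarrow> 'a set) \<Rightarrow> ('g \<Rightarrow> 'b set) \<Rightarrow> (nat \<Rightarrow> 'a list \<Rightarrow> 'b) \<Rightarrow> 'g \<Rightarrow> bool" where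
  "has_degree grA grB \<phi> k \<longleftrightarrow>
    (\<forall>n\<ge>1. \<forall>ds xs. length xs = n \<longrightarrow> homogeneous grA ds xs \<longrightarrow> \<phi> n xs \<in> grB (sum_list ds + k))"

text \<open>
  \<open>insert_sum s b \<psi> n ds xs\<close> is the value of
  \<open>\<Sum>\<^bsub>r+s+t=n\<^esub> \<psi>\<^bsub>r+1+t\<^esub> \<circ> (1\<^bsup>\<otimes>r\<^esup> \<otimes> b\<^sub>s \<otimes> 1\<^bsup>\<otimes>t\<^esup>)\<close> on the tensor \<open>xs\<close> of elements of degrees \<open>ds\<close>;
  the sign comes from moving \<open>b\<^sub>s\<close>, of degree \<open>1\<close>, past the first \<open>r\<close> elements.
\<close>

definition insert_sum ::
  "('k::field \<Rightarrow> 'b::ab_group_add \<Rightarrow> 'b) \<Rightarrow> (nat \<Rightarrow> 'a list \<Rightarrow> 'a) \<Rightarrow> (nat \<Rightarrow> 'a list \<Rightarrow> 'b) \<Rightarrow>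
    nat \<Rightarrow> 'g::ring_parity list \<Rightarrow> 'a list \<Rightarrow> 'b" where
  "insert_sum sB b \<psi> n ds xs =
    (\<Sum>(r, s, t) \<in> {(r, s, t). s \<ge> 1 \<and> r + s + t = n}.
      sB (ksign (sum_list (take r ds)))
        (\<psi> (r + 1 + t) (take r xs @ [b s (take s (drop r xs))] @ drop (r + s) xs)))"

text \<open>
  \<open>tensor_apply \<phi> [i\<^sub>1, \<dots>, i\<^sub>r] xs\<close> lists the factors of \<open>(\<phi>\<^bsub>i\<^sub>1\<^esub> \<otimes> \<dots> \<otimes> \<phi>\<^bsub>i\<^sub>r\<^esub>)(xs)\<close> for \<open>\<phi>\<close> of degree \<open>0\<close>
  (hence no sign), consuming \<open>i\<^sub>1 + \<dots> + i\<^sub>r\<close> elements of \<open>xs\<close> and ignoring the rest.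
\<close>

fun tensor_apply :: "(nat \<Rightarrow> 'a list \<Rightarrow> 'b) \<Rightarrow> nat list \<Rightarrow> 'a list \<Rightarrow> 'b list" where
  "tensor_apply \<phi> [] xs = []"
| "tensor_apply \<phi> (i # is) xs = \<phi> i (take i xs) # tensor_apply \<phi> is (drop i xs)"

definition compositions :: "nat \<Rightarrow> nat list set" where
  "compositions n = {is. (\<forall>i\<in>set is. i > 0) \<and> sum_list is = n}"

text \<open>
  The position of \<open>k\<close> in the word \<open>\<sigma>(0) \<dots> \<sigma>(n-1)\<close> is \<open>inv \<sigma> k\<close>; indices start at \<open>0\<close>, so the
  two blocks are \<open>{..<r}\<close> and \<open>{r..<n}\<close>.
\<close>

definition shuffle_perms :: "nat \<Rightarrow> nat \<Rightarrow> (nat \<Rightarrow> nat) set" where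
  "shuffle_perms r n =
    {\<sigma>. \<sigma> permutes {..<n} \<and>
        (\<forall>i j. i < j \<and> j < r \<longrightarrow> inv \<sigma> i < inv \<sigma> j) \<and>
        (\<forall>i j. r \<le> i \<and> i < j \<and> j < n \<longrightarrow> inv \<sigma> i < inv \<sigma> j)}"

definition shuffle_exponent :: "nat \<Rightarrow> nat \<Rightarrow> 'g::ring_parity list \<Rightarrow> (nat \<Rightarrow> nat) \<Rightarrow> 'g" where
  "shuffle_exponent r n ds \<sigma> =
    (\<Sum>(i, j) \<in> {(i, j). i < r \<and> r \<le> j \<and> j < n \<and> inv \<sigma> j < inv \<sigma> i}. ds ! i * ds ! j)"

text \<open>
  The degree \<open>n\<close> part of the image of the shuffle product is spanned by the products of tensors
  of homogeneous elements, so the linear map \<open>\<phi>\<^sub>n\<close> vanishes on it iff the image under \<open>\<phi>\<^sub>n\<close> of each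
  such product is \<open>0\<close>.
\<close>

definition vanishes_on_shuffles ::
  "('g::ring_parity \<Rightarrow> 'a set) \<Rightarrow> ('k::field \<Rightarrow> 'b::ab_group_add \<Rightarrow> 'b) \<Rightarrow>
    (nat \<Rightarrow> 'a list \<Rightarrow> 'b) \<Rightarrow> bool" where
  "vanishes_on_shuffles grA sB \<phi> \<longleftrightarrow>
    (\<forall>n\<ge>2. \<forall>r ds xs. 0 < r \<longrightarrow> r < n \<longrightarrow> length xs = n \<longrightarrow> homogeneous grA ds xs \<longrightarrow>
      (\<Sum>\<sigma> \<in> shuffle_perms r n.
        sB (ksign (shuffle_exponent r n ds \<sigma>)) (\<phi> n (map (\<lambda>i. xs ! \<sigma> i) [0..<n]))) = 0)"

locale A_infinity_algebra = graded_vector_space scale gr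
  for scale :: "'k::field \<Rightarrow> 'a::ab_group_add \<Rightarrow> 'a" and gr :: "'g::ring_parity \<Rightarrow> 'a set" +
  fixes b :: "nat \<Rightarrow> 'a list \<Rightarrow> 'a"
  assumes multilinear_b: "multilinear_family scale scale b"
    and degree_b: "has_degree gr gr b 1"
    and A_infinity_relation:
      "\<lbrakk>n \<ge> 1; length xs = n; homogeneous gr ds xs\<rbrakk> \<Longrightarrow> insert_sum scale b b n ds xs = 0"

locale A_infinity_morphism =
  A: A_infinity_algebra sA grA bA + B: A_infinity_algebra sB grB bB
  for sA :: "'k::field \<Rightarrow> 'a::ab_group_add \<Rightarrow> 'a" and grA :: "'g::ring_parity \<Rightarrow> 'a set" and bA
    and sB :: "'k \<Rightarrow> 'b::ab_group_add \<Rightarrow> 'b" and grB :: "'g \<Rightarrow> 'b set" and bB +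
  fixes f :: "nat \<Rightarrow> 'a list \<Rightarrow> 'b"
  assumes multilinear_f: "multilinear_family sA sB f"
    and degree_f: "has_degree grA grB f 0"
    and morphism_relation:
      "\<lbrakk>n \<ge> 1; length xs = n; homogeneous grA ds xs\<rbrakk> \<Longrightarrow>
        insert_sum sB bA f n ds xs = (\<Sum>is \<in> compositions n. bB (length is) (tensor_apply f is xs))"

text \<open>
  In the homotopy relation \<open>f\<close> and \<open>g\<close> have degree \<open>0\<close>, so the only sign in the first sum comes from
  moving \<open>\<eta>\<^sub>s\<close>, of degree \<open>-1\<close>, past the elements consumed by \<open>g\<close>.
\<close>

locale A_infinity_homotopy =
  f: A_infinity_morphism sA grA bA sB grB bB f + g: A_infinity_morphism sA grA bA sB grB bB g
  for sA :: "'k::field \<Rightarrow> 'a::ab_group_add \<Rightarrow> 'a" and grA :: "'g::ring_parity \<Rightarrow> 'a set" and bA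
    and sB :: "'k \<Rightarrow> 'b::ab_group_add \<Rightarrow> 'b" and grB :: "'g \<Rightarrow> 'b set" and bB and f g +
  fixes \<eta> :: "nat \<Rightarrow> 'a list \<Rightarrow> 'b"
  assumes multilinear_\<eta>: "multilinear_family sA sB \<eta>"
    and degree_\<eta>: "has_degree grA grB \<eta> (- 1)"
    and homotopy_relation:
      "\<lbrakk>n \<ge> 1; length xs = n; homogeneous grA ds xs\<rbrakk> \<Longrightarrow>
        g n xs - f n xs =
          (\<Sum>(is, s, js) \<in> {(is, s, js). s \<ge> 1 \<and> (\<forall>i \<in> set is \<union> set js. i > 0) \<and>
                                       sum_list is + s + sum_list js = n}.
            sB (ksign (sum_list (take (sum_list is) ds)))
              (bB (length is + 1 + length js)
                (tensor_apply g is xs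
                  @ [\<eta> s (take s (drop (sum_list is) xs))]
                  @ tensor_apply f js (drop (sum_list is + s) xs))))
          + insert_sum sB bA \<eta> n ds xs"

locale C_infinity_algebra = A_infinity_algebra scale gr b
  for scale :: "'k::field \<Rightarrow> 'a::ab_group_add \<Rightarrow> 'a" and gr :: "'g::ring_parity \<Rightarrow> 'a set" and b +
  assumes shuffle_b: "vanishes_on_shuffles gr scale b"

locale C_infinity_morphism =
  A: C_infinity_algebra sA grA bA + B: C_infinity_algebra sB grB bB
  + A_infinity_morphism sA grA bA sB grB bB f
  for sA :: "'k::field \<Rightarrow> 'a::ab_group_add \<Rightarrow> 'a" and grA :: "'g::ring_parity \<Rightarrow> 'a set" and bA
    and sB :: "'k \<Rightarrow> 'b::ab_group_add \<Rightarrow> 'b" and grB :: "'g \<Rightarrow> 'b set" and bB and f +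
  assumes shuffle_f: "vanishes_on_shuffles grA sB f"

locale C_infinity_homotopy =
  f: C_infinity_morphism sA grA bA sB grB bB f + g: C_infinity_morphism sA grA bA sB grB bB g
  + A_infinity_homotopy sA grA bA sB grB bB f g \<eta>
  for sA :: "'k::field \<Rightarrow> 'a::ab_group_add \<Rightarrow> 'a" and grA :: "'g::ring_parity \<Rightarrow> 'a set" and bA
    and sB :: "'k \<Rightarrow> 'b::ab_group_add \<Rightarrow> 'b" and grB :: "'g \<Rightarrow> 'b set" and bB and f g \<eta> +
  assumes shuffle_\<eta>: "vanishes_on_shuffles grA sB \<eta>"

definition closed_element :: "(nat \<Rightarrow> 'a list \<Rightarrow> 'a::ab_group_add) \<Rightarrow> 'a \<Rightarrow> bool" where
  "closed_element b h \<longleftrightarrow> b 1 [h] = 0"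

definition of_even_degree :: "('g::ring_parity \<Rightarrow> 'a set) \<Rightarrow> 'a \<Rightarrow> bool" where
  "of_even_degree gr h \<longleftrightarrow> (\<exists>d. even d \<and> h \<in> gr d)"

text \<open>
  \<open>diagonal_sum \<phi> h v\<close> states that \<open>\<Sum>\<^bsub>n\<ge>1\<^esub> \<phi>\<^sub>n(h, \<dots>, h) = v\<close>.  There is no topology on the target, so
  the sum is required to have only finitely many nonzero terms; a relation is used so that a
  sum with infinitely many nonzero terms has no value.
\<close>

definition diagonal_sum :: "(nat \<Rightarrow> 'a list \<Rightarrow> 'b::ab_group_add) \<Rightarrow> 'a \<Rightarrow> 'b \<Rightarrow> bool" where
  "diagonal_sum \<phi> h v \<longleftrightarrow>
    finite {n. n \<ge> 1 \<and> \<phi> n (replicate n h) \<noteq> 0} \<and>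
    (\<Sum>n | n \<ge> 1 \<and> \<phi> n (replicate n h) \<noteq> 0. \<phi> n (replicate n h)) = v"

definition twisting_element ::
  "('g::ring_parity \<Rightarrow> 'a set) \<Rightarrow> (nat \<Rightarrow> 'a list \<Rightarrow> 'a::ab_group_add) \<Rightarrow> 'a \<Rightarrow> bool" where
  "twisting_element gr b h \<longleftrightarrow> of_even_degree gr h \<and> diagonal_sum b h 0"

end

theory Submission
  imports Defs
begin

text \<open>
  All three parts come down to one observation about a family \<open>\<phi>\<close> vanishing on shuffles and an
  element \<open>h\<close> of even degree: in the shuffle product of \<open>h\<^bsup>\<otimes>r\<^esup>\<close> and \<open>h\<^bsup>\<otimes>(n-r)\<^esup>\<close> every
  shuffle contributes \<open>h\<^bsup>\<otimes>n\<^esup>\<close> with sign \<open>+1\<close>, so this product is \<open>N \<cdot> h\<^bsup>\<otimes>n\<^esup>\<close>, where \<open>N\<close> is the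
  number of shuffles.  As \<open>N\<close> is positive and the characteristic is \<open>0\<close>, \<open>\<phi>\<^sub>n(h, \<dots>, h) = 0\<close> for all
  \<open>n \<ge> 2\<close> (\<open>vanishes_on_shuffles_replicate\<close>), and the diagonal sum of \<open>\<phi>\<close> at \<open>h\<close> reduces to
  \<open>\<phi>\<^sub>1(h)\<close>.  Apply this to \<open>b\<close>, \<open>f\<close> and \<open>\<eta>\<close>; for \<open>b\<close> the surviving term is \<open>b\<^sub>1(h) = 0\<close>.
\<close>

text \<open>
  The number of shuffles is a binomial coefficient, but division by it only requires that it is
  not zero, and the identity is always a shuffle.
\<close>

lemma card_shuffle_perms_pos: "card (shuffle_perms r n) > 0"
proof -
  have "shuffle_perms r n \<subseteq> {\<sigma>. \<sigma> permutes {..<n}}"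
    by (auto simp: shuffle_perms_def)
  then have "finite (shuffle_perms r n)"
    by (rule finite_subset) (simp add: finite_permutations)
  moreover have "id \<in> shuffle_perms r n"
    by (simp add: shuffle_perms_def permutes_id)
  ultimately show ?thesis
    by (auto simp: card_gt_0_iff)
qed

lemma even_shuffle_exponent_replicate:
  assumes "even d"
  shows "even (shuffle_exponent r n (replicate n d) \<sigma>)"
  unfolding shuffle_exponent_def using assms by (auto intro!: dvd_sum)

lemma vanishes_on_shuffles_replicate:
  fixes sB :: "'k::field_char_0 \<Rightarrow> 'b::ab_group_add \<Rightarrow> 'b"
  assumes "vector_space sB" and van: "vanishes_on_shuffles grA sB \<phi>"
    and "of_even_degree grA h" and "n \<ge> 2"
  shows "\<phi> n (replicate n h) = 0"
proof -
  interpret vector_space sB by fact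
  let ?v = "\<phi> n (replicate n h)"
  obtain d where d: "even d" "h \<in> grA d"
    using assms(3) by (auto simp: of_even_degree_def)
  have "homogeneous grA (replicate n d) (replicate n h)"
    using d by (simp add: homogeneous_def list_all2_conv_all_nth)
  \<comment> \<open>Any cut \<open>0 < r < n\<close> would serve; \<open>r = 1\<close> is available for every \<open>n \<ge> 2\<close>.\<close>
  then have "(\<Sum>\<sigma> \<in> shuffle_perms 1 n. sB (ksign (shuffle_exponent 1 n (replicate n d) \<sigma>))
      (\<phi> n (map (\<lambda>i. replicate n h ! \<sigma> i) [0..<n]))) = 0"
    using van \<open>n \<ge> 2\<close> by (auto simp: vanishes_on_shuffles_def)
  moreover have "map (\<lambda>i. replicate n h ! \<sigma> i) [0..<n] = replicate n h"
    if "\<sigma> \<in> shuffle_perms 1 n" for \<sigma>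
  proof (rule nth_equalityI)
    fix i assume "i < length (map (\<lambda>i. replicate n h ! \<sigma> i) [0..<n])"
    moreover have "\<sigma> permutes {..<n}"
      using that by (simp add: shuffle_perms_def)
    ultimately show "map (\<lambda>i. replicate n h ! \<sigma> i) [0..<n] ! i = replicate n h ! i"
      using permutes_in_image[of \<sigma> "{..<n}" i] by simp
  qed simp
  ultimately have "(\<Sum>\<sigma> \<in> shuffle_perms 1 n. ?v) = 0"
    using even_shuffle_exponent_replicate[OF d(1)] by (simp add: ksign_def)
  then have "sB (of_nat (card (shuffle_perms 1 n))) ?v = 0"
    by (simp only: sum_constant_scale)
  then show ?thesis
    using card_shuffle_perms_pos[of 1 n] by simp
qed

lemma diagonal_sum_vanishes_on_shuffles:
  fixes sB :: "'k::field_char_0 \<Rightarrow> 'b::ab_group_add \<Rightarrow> 'b"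
  assumes "vector_space sB" "vanishes_on_shuffles grA sB \<phi>" "of_even_degree grA h"
  shows "diagonal_sum \<phi> h (\<phi> 1 [h])"
proof -
  have "\<phi> n (replicate n h) = 0" if "n \<ge> 2" for n
    using vanishes_on_shuffles_replicate[OF assms that] .
  then have "n = 1" if "n \<ge> 1" "\<phi> n (replicate n h) \<noteq> 0" for n
    using that by (metis One_nat_def Suc_1 le_antisym not_less_eq_eq)
  then have "{n. n \<ge> 1 \<and> \<phi> n (replicate n h) \<noteq> 0} = (if \<phi> 1 [h] = 0 then {} else {1})"
    by force
  then show ?thesis
    by (simp add: diagonal_sum_def)
qed

theorem proposition3p18:
  fixes sA :: "'k::field_char_0 \<Rightarrow> 'a::ab_group_add \<Rightarrow> 'a"
    and grA :: "'g::ring_parity \<Rightarrow> 'a set"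
    and bA :: "nat \<Rightarrow> 'a list \<Rightarrow> 'a"
    and sB :: "'k \<Rightarrow> 'b::ab_group_add \<Rightarrow> 'b"
    and grB :: "'g \<Rightarrow> 'b set"
    and bB :: "nat \<Rightarrow> 'b list \<Rightarrow> 'b"
  shows
    "(C_infinity_algebra sA grA bA \<longrightarrow>
        (\<forall>h. closed_element bA h \<and> of_even_degree grA h \<longrightarrow> twisting_element grA bA h)) \<and>
     (\<forall>f. C_infinity_morphism sA grA bA sB grB bB f \<longrightarrow>
        (\<forall>h. closed_element bA h \<and> of_even_degree grA h \<longrightarrow> diagonal_sum f h (f 1 [h]))) \<and>
     (\<forall>f g \<eta>. C_infinity_homotopy sA grA bA sB grB bB f g \<eta> \<longrightarrow>
        (\<forall>h. closed_element bA h \<and> of_even_degree grA h \<longrightarrow> diagonal_sum \<eta> h (\<eta> 1 [h])))"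
proof (intro conjI allI impI; elim conjE)
  fix h assume A: "C_infinity_algebra sA grA bA"
    and h: "closed_element bA h" "of_even_degree grA h"
  interpret C_infinity_algebra sA grA bA by fact
  have "diagonal_sum bA h (bA 1 [h])"
    using vector_space_axioms shuffle_b h(2) by (rule diagonal_sum_vanishes_on_shuffles)
  then show "twisting_element grA bA h"
    using h by (simp add: twisting_element_def closed_element_def)
next
  fix f h assume f: "C_infinity_morphism sA grA bA sB grB bB f"
    and h: "of_even_degree grA h"
  interpret C_infinity_morphism sA grA bA sB grB bB f by fact
  show "diagonal_sum f h (f 1 [h])"
    using B.vector_space_axioms shuffle_f h by (rule diagonal_sum_vanishes_on_shuffles)
next
  fix f g \<eta> h assume H: "C_infinity_homotopy sA grA bA sB grB bB f g \<eta>"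
    and h: "of_even_degree grA h"
  interpret C_infinity_homotopy sA grA bA sB grB bB f g \<eta> by fact
  show "diagonal_sum \<eta> h (\<eta> 1 [h])"
    using f.B.vector_space_axioms shuffle_\<eta> h by (rule diagonal_sum_vanishes_on_shuffles)
qed

end
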